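(* For any arborescence or anti-arborescence $T$, we have $\chi_{d}(T)=\chi_{d}(T^{-})$, where $T^{-}$ is $T$ with the orientation of every arc reversed.
   Context: All digraphs are orientations of finite simple trees. An arborescence (out-tree) is an orientation of a tree in which all arcs point away from a single source; an anti-arborescence (in-tree) is an orientation of a tree in which all arcs point towards a single sink. For a vertex $v$ of a digraph $D$, $N^{+}(v)$ denotes the open out-neighborhood, i.e. the set of vertices $w$ such that $(v,w)$ is an arc; $v$ dominates each vertex of $N^{+}(v)$. A dominator coloring of $D$ is a proper vertex coloring (adjacent vertices of the underlying graph receive different colors) such that every vertex $v$ with $N^{+}(v)\neq\emptyset$ dominates at least one color class, i.e. there is a nonempty color class contained in $N^{+}(v)$ (vertices of out-degree zero are exempt). The dominator chromatic number $\chi_{d}(D)$ is the minimum number of colors in a dominator coloring of $D$. *)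

theory Defs
  imports "Graph_Theory.Graph_Theory"
begin

definition out_nbhd :: "'a pair_pre_digraph \<Rightarrow> 'a \<Rightarrow> 'a set" where
  "out_nbhd D v = {w. (v, w) \<in> parcs D}"

definition reverse_digraph :: "'a pair_pre_digraph \<Rightarrow> 'a pair_pre_digraph" where
  "reverse_digraph D = \<lparr>pverts = pverts D, parcs = (parcs D)\<inverse>\<rparr>"

text \<open>
  An undirected graph is represented by its symmetric digraph, here \<open>mk_symmetric D\<close>. There
  the library's notion of cycle also admits the walk \<open>u, v, u\<close> along a single edge, so
  cycles of the undirected graph are those of length at least 3. (The library's predicate
  \<open>tree\<close> only excludes directed cycles and hence does not describe orientations of trees.)
  Connectedness includes that there is at least one vertex.
\<close>

definition oriented_tree :: "'a pair_pre_digraph \<Rightarrow> bool" where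
  "oriented_tree D \<longleftrightarrow>
     pair_digraph D \<and>
     (\<forall>u v. (u, v) \<in> parcs D \<longrightarrow> (v, u) \<notin> parcs D) \<and>
     connected (with_proj D) \<and>
     (\<nexists>p. pre_digraph.cycle (with_proj (mk_symmetric (with_proj D))) p \<and> length p \<ge> 3)"

text \<open>
  An arc \<open>(u, v)\<close> of an oriented tree points away from \<open>r\<close> if the path of the underlying
  tree from \<open>r\<close> to \<open>v\<close> traverses it from \<open>u\<close> to \<open>v\<close>, and towards \<open>s\<close> if the path from
  \<open>u\<close> to \<open>s\<close> does. In particular, no arc enters \<open>r\<close> and no arc leaves \<open>s\<close>.
\<close>

definition points_away :: "'a pair_pre_digraph \<Rightarrow> 'a \<Rightarrow> 'a \<times> 'a \<Rightarrow> bool" where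
  "points_away D r a \<longleftrightarrow>
     (\<forall>p. pre_digraph.apath (with_proj (mk_symmetric (with_proj D))) r p (snd a) \<longrightarrow> a \<in> set p)"

definition points_towards :: "'a pair_pre_digraph \<Rightarrow> 'a \<Rightarrow> 'a \<times> 'a \<Rightarrow> bool" where
  "points_towards D s a \<longleftrightarrow>
     (\<forall>p. pre_digraph.apath (with_proj (mk_symmetric (with_proj D))) (fst a) p s \<longrightarrow> a \<in> set p)"

definition arborescence :: "'a pair_pre_digraph \<Rightarrow> bool" where
  "arborescence D \<longleftrightarrow>
     oriented_tree D \<and> (\<exists>r \<in> pverts D. \<forall>a \<in> parcs D. points_away D r a)"

definition anti_arborescence :: "'a pair_pre_digraph \<Rightarrow> bool" where
  "anti_arborescence D \<longleftrightarrow>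
     oriented_tree D \<and> (\<exists>s \<in> pverts D. \<forall>a \<in> parcs D. points_towards D s a)"

definition color_class :: "'a pair_pre_digraph \<Rightarrow> ('a \<Rightarrow> nat) \<Rightarrow> nat \<Rightarrow> 'a set" where
  "color_class D c i = {w \<in> pverts D. c w = i}"

definition proper_coloring :: "'a pair_pre_digraph \<Rightarrow> ('a \<Rightarrow> nat) \<Rightarrow> bool" where
  "proper_coloring D c \<longleftrightarrow> (\<forall>(u, v) \<in> parcs D. c u \<noteq> c v)"

definition dominator_coloring :: "'a pair_pre_digraph \<Rightarrow> ('a \<Rightarrow> nat) \<Rightarrow> bool" where
  "dominator_coloring D c \<longleftrightarrow>
     proper_coloring D c \<and>
     (\<forall>v \<in> pverts D. out_nbhd D v \<noteq> {} \<longrightarrow>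
        (\<exists>i. color_class D c i \<noteq> {} \<and> color_class D c i \<subseteq> out_nbhd D v))"

definition dominator_chromatic_number :: "'a pair_pre_digraph \<Rightarrow> nat" where
  "dominator_chromatic_number D =
     (LEAST k. \<exists>c. dominator_coloring D c \<and> card (c ` pverts D) = k)"

text \<open>The minimum is attained: any injective coloring is a dominator coloring.\<close>

lemma ex_dominator_coloring:
  fixes D :: "'a pair_pre_digraph"
  assumes "pair_digraph D"
  shows "\<exists>c. dominator_coloring D c"
proof -
  interpret pair_digraph D by fact
  obtain c :: "'a \<Rightarrow> nat" where c: "inj_on c (pverts D)"
    using finite_imp_inj_to_nat_seg[OF pair_finite_verts] by auto
  have "c u \<noteq> c v" if "(u, v) \<in> parcs D" for u v
    using wellformed'[OF that] no_loops'[OF that] c by (auto dest: inj_onD)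
  moreover have "color_class D c (c w) = {w}" if "(v, w) \<in> parcs D" for v w
    unfolding color_class_def using in_arcsD2[OF that] c by (auto dest: inj_onD)
  ultimately have "dominator_coloring D c"
    unfolding dominator_coloring_def proper_coloring_def out_nbhd_def by fastforce
  then show ?thesis by blast
qed

end

theory Submission
  imports Defs
begin

text \<open>
  Both numbers equal the number of internal vertices (those with a child) plus one.

  In an arborescence every vertex but the root has exactly one in-neighbour, its parent. Oriented
  away from the root, every internal vertex dominates a color class consisting of children of its
  own. Vertices with different parents lie in different classes of this kind, and the root, being
  nobody's child, lies in none of them; so there are at least as many colors as internal vertices,
  plus one. Coloring each vertex by its parent, and the root separately, attains this bound.

  Oriented towards the root, a vertex other than the root has its parent as only out-neighbour, so
  a proper coloring is a dominator coloring exactly if every internal vertex is alone in its color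
  class. The leaves, of which there is at least one, need a further color, and because
  they are pairwise nonadjacent one color suffices for them all.

  An anti-arborescence is the reversal of an arborescence, so the two orientations above cover
  both cases. The structural facts are \<open>arborescence_rooted\<close> and
  \<open>anti_arborescence_reverse\<close>; the two numbers are computed in
  \<open>dominator_chromatic_number_away\<close> and \<open>dominator_chromatic_number_towards\<close>.
\<close>

section \<open>Dominator colorings of rooted parent structures\<close>

lemma dominator_chromatic_number_eqI:
  assumes "dominator_coloring D c" "card (c ` pverts D) = k"
    and "\<And>c'. dominator_coloring D c' \<Longrightarrow> k \<le> card (c' ` pverts D)"
  shows "dominator_chromatic_number D = k"
  unfolding dominator_chromatic_number_def using assms by (intro Least_equality) auto

text \<open>
  All that the count of colors uses of an arborescence is that its arcs join the parent of each
  vertex other than the root to that vertex. The parent of the root is left unconstrained, which is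
  why every condition on \<open>parent\<close> is restricted to the other vertices.
\<close>

locale rooted_digraph =
  fixes T :: "'a pair_pre_digraph" and r :: 'a and parent :: "'a \<Rightarrow> 'a"
  assumes finite_verts: "finite (pverts T)"
    and root: "r \<in> pverts T"
    and arc_iff: "(u, v) \<in> parcs T \<longleftrightarrow> v \<in> pverts T - {r} \<and> u = parent v"
    and parent_in: "v \<in> pverts T - {r} \<Longrightarrow> parent v \<in> pverts T"
    and parent_neq: "v \<in> pverts T - {r} \<Longrightarrow> parent v \<noteq> v"
begin

definition internal :: "'a set" where
  "internal = parent ` (pverts T - {r})"

lemma internal_subset: "internal \<subseteq> pverts T"
  using parent_in by (auto simp: internal_def)

lemma finite_internal: "finite internal"
  using finite_verts by (simp add: internal_def)

text \<open>The root is no vertex's child, so there are fewer parents than vertices.\<close>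

lemma ex_leaf: "\<exists>l \<in> pverts T. l \<notin> internal"
proof -
  have "card internal \<le> card (pverts T - {r})"
    unfolding internal_def using finite_verts by (intro card_image_le) simp
  also have "\<dots> < card (pverts T)"
    using finite_verts root by (intro card_Diff1_less)
  finally have "internal \<noteq> pverts T" by auto
  with internal_subset show ?thesis by auto
qed

text \<open>
  Both lower bounds have this form: the internal vertices account for distinct colors, namely their
  own or that of a class they dominate, and some vertex, a leaf or the root, avoids all of them.
\<close>

lemma internal_coloring_ge:
  fixes c :: "'a \<Rightarrow> nat"
  assumes "inj_on g internal" "g ` internal \<subseteq> c ` pverts T"
    and "v \<in> pverts T" "c v \<notin> g ` internal"
  shows "card internal + 1 \<le> card (c ` pverts T)"
proof -
  have "card internal + 1 = card (insert (c v) (g ` internal))"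
    using assms finite_internal by (simp add: card_image)
  also have "\<dots> \<le> card (c ` pverts T)"
    using assms finite_verts by (intro card_mono) auto
  finally show ?thesis .
qed

lemma dominator_chromatic_number_away: "dominator_chromatic_number T = card internal + 1"
proof -
  obtain f :: "'a \<Rightarrow> nat" where f: "inj_on f (pverts T)"
    using finite_imp_inj_to_nat_seg[OF finite_verts] by auto
  (* Each class is the full set of children of one internal vertex; the root is alone. *)
  define c where "c v = (if v = r then 0 else Suc (f (parent v)))" for v
  have proper: "proper_coloring T c"
    unfolding proper_coloring_def
    using parent_in parent_neq
    by (auto simp: arc_iff c_def inj_on_eq_iff[OF f] split: if_splits)
  have dom: "\<exists>i. color_class T c i \<noteq> {} \<and> color_class T c i \<subseteq> out_nbhd T u"
    if "out_nbhd T u \<noteq> {}" for u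
  proof -
    from that obtain w where w: "w \<in> pverts T - {r}" "u = parent w"
      by (auto simp: out_nbhd_def arc_iff)
    then have "w \<in> color_class T c (c w)"
      by (simp add: color_class_def)
    moreover have "color_class T c (c w) \<subseteq> out_nbhd T u"
      using w parent_in
      by (auto simp: color_class_def out_nbhd_def arc_iff c_def inj_on_eq_iff[OF f]
          split: if_splits)
    ultimately show ?thesis by blast
  qed
  show ?thesis
  proof (rule dominator_chromatic_number_eqI)
    show "dominator_coloring T c"
      using proper dom by (auto simp: dominator_coloring_def)
    have "c ` pverts T = insert 0 (Suc ` f ` internal)"
      using root by (force simp: c_def internal_def image_iff)
    moreover have "card (Suc ` f ` internal) = card internal"
      using f internal_subset by (simp add: card_image inj_on_subset)
    ultimately show "card (c ` pverts T) = card internal + 1"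
      using finite_internal by (auto simp: card_insert_if)
  next
    fix c' assume c': "dominator_coloring T c'"
    have "\<forall>u\<in>internal. \<exists>i. color_class T c' i \<noteq> {} \<and> color_class T c' i \<subseteq> out_nbhd T u"
    proof
      fix u assume u: "u \<in> internal"
      then have "out_nbhd T u \<noteq> {}"
        by (auto simp: internal_def out_nbhd_def arc_iff)
      with c' u internal_subset
      show "\<exists>i. color_class T c' i \<noteq> {} \<and> color_class T c' i \<subseteq> out_nbhd T u"
        by (auto simp: dominator_coloring_def)
    qed
    then obtain g where g: "\<And>u. u \<in> internal \<Longrightarrow> color_class T c' (g u) \<noteq> {}"
        "\<And>u. u \<in> internal \<Longrightarrow> color_class T c' (g u) \<subseteq> out_nbhd T u"
      by metis
    show "card internal + 1 \<le> card (c' ` pverts T)"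
    proof (rule internal_coloring_ge)
      show "inj_on g internal"
      proof (rule inj_onI)
        fix u u' assume uu': "u \<in> internal" "u' \<in> internal" "g u = g u'"
        then obtain w where "w \<in> out_nbhd T u" "w \<in> out_nbhd T u'"
          using g by (metis all_not_in_conv subsetD)
        then show "u = u'" by (auto simp: out_nbhd_def arc_iff)
      qed
      show "g ` internal \<subseteq> c' ` pverts T"
      proof
        fix i assume "i \<in> g ` internal"
        then have "color_class T c' i \<noteq> {}" using g(1) by blast
        then show "i \<in> c' ` pverts T" by (auto simp: color_class_def)
      qed
      show "r \<in> pverts T" by (rule root)
      show "c' r \<notin> g ` internal"
      proof
        assume "c' r \<in> g ` internal"
        then obtain u where "u \<in> internal" "r \<in> color_class T c' (g u)"
          using root by (auto simp: color_class_def)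
        then have "r \<in> out_nbhd T u" using g(2) by blast
        then show False by (simp add: out_nbhd_def arc_iff)
      qed
    qed
  qed
qed

lemma out_nbhd_reverse:
  "out_nbhd (reverse_digraph T) v = (if v \<in> pverts T - {r} then {parent v} else {})"
  by (auto simp: out_nbhd_def reverse_digraph_def arc_iff)

text \<open>
  The internal vertices are exactly those that are the only out-neighbour of some vertex in the
  reversed digraph, and a nonempty class inside a singleton is that singleton.
\<close>

lemma dominator_coloring_reverse_iff:
  "dominator_coloring (reverse_digraph T) c \<longleftrightarrow>
     proper_coloring (reverse_digraph T) c \<and>
     (\<forall>u \<in> internal. \<forall>v \<in> pverts T. c v = c u \<longrightarrow> v = u)"
proof -
  have class_eq: "color_class (reverse_digraph T) c i = {w \<in> pverts T. c w = i}" for i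
    by (simp add: color_class_def reverse_digraph_def)
  have "(\<exists>i. color_class (reverse_digraph T) c i \<noteq> {} \<and>
          color_class (reverse_digraph T) c i \<subseteq> {u}) \<longleftrightarrow>
        (\<forall>v \<in> pverts T. c v = c u \<longrightarrow> v = u)" (is "?L \<longleftrightarrow> ?R") if "u \<in> pverts T" for u
  proof
    assume ?L
    then show ?R unfolding class_eq by blast
  next
    assume ?R
    with that have "color_class (reverse_digraph T) c (c u) = {u}"
      unfolding class_eq by auto
    then show ?L by blast
  qed
  moreover have "pverts (reverse_digraph T) = pverts T"
    by (simp add: reverse_digraph_def)
  ultimately show ?thesis
    using parent_in by (auto simp add: dominator_coloring_def out_nbhd_reverse internal_def)
qed

lemma dominator_chromatic_number_towards:
  "dominator_chromatic_number (reverse_digraph T) = card internal + 1"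
proof -
  obtain f :: "'a \<Rightarrow> nat" where f: "inj_on f (pverts T)"
    using finite_imp_inj_to_nat_seg[OF finite_verts] by auto
  obtain l where l: "l \<in> pverts T" "l \<notin> internal"
    using ex_leaf by blast
  have verts: "pverts (reverse_digraph T) = pverts T"
    by (simp add: reverse_digraph_def)
  (* Internal vertices get distinct positive colors, all leaves share the color 0. *)
  define c where "c v = (if v \<in> internal then Suc (f v) else 0)" for v
  show ?thesis
  proof (rule dominator_chromatic_number_eqI)
    have "parent v \<in> internal" if "v \<in> pverts T - {r}" for v
      using that by (simp add: internal_def)
    then have "proper_coloring (reverse_digraph T) c"
      unfolding proper_coloring_def
      using parent_in parent_neq[symmetric]
      by (auto simp: reverse_digraph_def arc_iff c_def inj_on_eq_iff[OF f] split: if_splits)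
    moreover have "\<forall>u\<in>internal. \<forall>v\<in>pverts T. c v = c u \<longrightarrow> v = u"
      using internal_subset by (auto simp: c_def inj_on_eq_iff[OF f] subset_iff)
    ultimately show "dominator_coloring (reverse_digraph T) c"
      by (simp add: dominator_coloring_reverse_iff)
    have "c ` pverts T = insert 0 (Suc ` f ` internal)"
      using l internal_subset by (force simp: c_def image_iff)
    moreover have "card (Suc ` f ` internal) = card internal"
      using f internal_subset by (simp add: card_image inj_on_subset)
    ultimately show "card (c ` pverts (reverse_digraph T)) = card internal + 1"
      using finite_internal by (auto simp: verts card_insert_if)
  next
    fix c' assume "dominator_coloring (reverse_digraph T) c'"
    then have c': "\<And>u v. \<lbrakk>u \<in> internal; v \<in> pverts T; c' v = c' u\<rbrakk> \<Longrightarrow> v = u"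
      by (auto simp: dominator_coloring_reverse_iff)
    have "card internal + 1 \<le> card (c' ` pverts T)"
    proof (rule internal_coloring_ge)
      show "inj_on c' internal"
        using c' internal_subset by (auto intro: inj_onI)
      show "c' ` internal \<subseteq> c' ` pverts T"
        using internal_subset by blast
      show "l \<in> pverts T" by (rule l)
      show "c' l \<notin> c' ` internal"
        using c' l by auto
    qed
    then show "card internal + 1 \<le> card (c' ` pverts (reverse_digraph T))"
      by (simp add: verts)
  qed
qed

end

section \<open>The parent function of an arborescence\<close>

text \<open>
  A path has distinct vertices and hence enters each vertex at most once. Two arcs into \<open>v\<close>
  would both lie on a path from the root to \<open>v\<close>, so they are equal, and the trivial path shows
  that no arc enters the root. If \<open>v\<close> is not the root, then a path from the root to \<open>v\<close>
  has a last edge, joining some \<open>x\<close> to \<open>v\<close>. This edge is oriented towards \<open>v\<close>: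
  otherwise the arc \<open>(v, x)\<close> would have to lie on the part of the path that ends in \<open>x\<close>,
  which avoids \<open>v\<close>.
\<close>

lemma arborescence_rooted:
  assumes "arborescence T"
  obtains r parent where "rooted_digraph T r parent"
proof -
  let ?S = "mk_symmetric (with_proj T)"
  from assms obtain r where r: "r \<in> pverts T" and away: "\<And>a. a \<in> parcs T \<Longrightarrow> points_away T r a"
    and dig: "pair_digraph T" and con: "connected (with_proj T)"
    by (auto simp: arborescence_def oriented_tree_def)
  interpret pair_digraph T by (rule dig)
  interpret S: pair_wf_digraph ?S by (rule wellformed_mk_symmetric)
  have on_path: "(u, v) \<in> set p" if "(u, v) \<in> parcs T" "S.apath r p v" for u v p
    using away[OF that(1)] that(2) by (simp add: points_away_def)
  have path: "\<exists>p. S.apath r p v" if "v \<in> pverts T" for v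
  proof -
    have "r \<rightarrow>\<^sup>*\<^bsub>with_proj ?S\<^esub> v"
      using con r that by (auto simp: connected_def strongly_connected_def)
    then show ?thesis by (simp add: S.reachable_apath)
  qed
  have unique: "u = u'" if arcs: "(u, v) \<in> parcs T" "(u', v) \<in> parcs T" for u u' v
  proof -
    obtain p where p: "S.apath r p v"
      using path in_arcsD2[OF arcs(1)] by blast
    then have "distinct (map snd p)"
      using S.awalk_verts_conv'[of r p v]
      by (auto simp: S.apath_def S.awalk_def split: if_splits)
    moreover have "(u, v) \<in> set p" "(u', v) \<in> set p"
      using on_path p arcs by blast+
    ultimately show ?thesis
      unfolding distinct_map inj_on_def by fastforce
  qed
  have no_arc_to_root: "(u, r) \<notin> parcs T" for u
    using on_path[of u r "[]"] r by (auto simp: S.apath_Nil_iff)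
  have ex_parent: "\<exists>u. (u, v) \<in> parcs T" if v: "v \<in> pverts T - {r}" for v
  proof -
    obtain p where p: "S.apath r p v"
      using path v by blast
    with v have "p \<noteq> []" by (auto simp: S.apath_Nil_iff)
    then obtain q e where pq: "p = q @ [e]" by (cases p rule: rev_cases) auto
    from p have e: "snd e = v" and "S.awlast r q = fst e" "S.apath r q (S.awlast r q)" "e \<in> parcs ?S"
      by (auto simp: pq S.apath_append_iff S.apath_simps)
    then have q: "S.apath r q (fst e)" and edge: "(fst e, v) \<in> parcs ?S"
      by auto
    have "(v, fst e) \<notin> parcs T"
    proof
      assume "(v, fst e) \<in> parcs T"
      with q have "(v, fst e) \<in> set q" by (rule on_path[rotated])
      then have "v \<in> fst ` set p" by (force simp: pq)
      moreover have "distinct (map fst p @ [v])"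
        using p S.awalk_verts_conv[of r p] e
        by (auto simp: S.apath_def pq)
      ultimately show False by auto
    qed
    with edge show ?thesis by (auto simp: parcs_mk_symmetric)
  qed
  define parent where "parent v = (THE u. (u, v) \<in> parcs T)" for v
  have parent: "(u, v) \<in> parcs T \<longleftrightarrow> v \<in> pverts T - {r} \<and> u = parent v" for u v
  proof
    assume uv: "(u, v) \<in> parcs T"
    then have "parent v = u"
      unfolding parent_def using unique by blast
    with uv no_arc_to_root show "v \<in> pverts T - {r} \<and> u = parent v"
      by (auto dest: in_arcsD2)
  next
    assume v: "v \<in> pverts T - {r} \<and> u = parent v"
    then obtain u' where "(u', v) \<in> parcs T" using ex_parent by blast
    moreover from this have "parent v = u'"
      unfolding parent_def using unique by blast
    ultimately show "(u, v) \<in> parcs T" using v by simp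
  qed
  have "rooted_digraph T r parent"
  proof
    show "parent v \<in> pverts T" "parent v \<noteq> v" if "v \<in> pverts T - {r}" for v
      using parent[of "parent v" v] that by (auto dest: in_arcsD1 no_loops')
  qed (use pair_finite_verts r parent in auto)
  then show ?thesis by (rule that)
qed

section \<open>Reversal\<close>

lemma reverse_reverse_digraph [simp]: "reverse_digraph (reverse_digraph D) = D"
  by (simp add: reverse_digraph_def)

lemma mk_symmetric_reverse:
  "mk_symmetric (with_proj (reverse_digraph D)) = mk_symmetric (with_proj D)"
  by (auto simp: mk_symmetric_def reverse_digraph_def)

lemma oriented_tree_reverse:
  assumes "oriented_tree D"
  shows "oriented_tree (reverse_digraph D)"
proof -
  from assms interpret pair_digraph D by (simp add: oriented_tree_def)
  have "pair_digraph (reverse_digraph D)"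
    by unfold_locales
      (auto simp: reverse_digraph_def pair_finite_verts pair_finite_arcs
        dest: in_arcsD1 in_arcsD2 no_loops')
  with assms show ?thesis
    unfolding oriented_tree_def connected_def mk_symmetric_reverse
    by (auto simp: reverse_digraph_def)
qed

lemma mem_rev_path_iff: "(u, v) \<in> set (rev_path p) \<longleftrightarrow> (v, u) \<in> set p"
  by (induct p) auto

text \<open>Paths of the underlying tree can be traversed in either direction.\<close>

lemma points_away_reverse:
  assumes "pair_digraph D" "points_towards D s (u, v)"
  shows "points_away (reverse_digraph D) s (v, u)"
proof -
  let ?S = "mk_symmetric (with_proj D)"
  interpret pair_digraph D by fact
  interpret S: pair_wf_digraph ?S by (rule wellformed_mk_symmetric)
  interpret S: pair_sym_digraph ?S
    by unfold_locales (rule symmetric_mk_symmetric)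
  have "(v, u) \<in> set p" if "S.apath s p u" for p
  proof -
    from that have "S.apath u (rev_path p) s" by simp
    with assms(2) have "(u, v) \<in> set (rev_path p)"
      by (simp add: points_towards_def)
    then show ?thesis by (simp add: mem_rev_path_iff)
  qed
  then show ?thesis by (simp add: points_away_def mk_symmetric_reverse)
qed

lemma anti_arborescence_reverse:
  assumes "anti_arborescence T"
  shows "arborescence (reverse_digraph T)"
proof -
  from assms obtain s where s: "s \<in> pverts T" "\<And>a. a \<in> parcs T \<Longrightarrow> points_towards T s a"
    and tree: "oriented_tree T"
    by (auto simp: anti_arborescence_def)
  from tree have "pair_digraph T" by (simp add: oriented_tree_def)
  then have "\<forall>a \<in> parcs (reverse_digraph T). points_away (reverse_digraph T) s a"
    using s(2) points_away_reverse by (fastforce simp: reverse_digraph_def)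
  moreover have "s \<in> pverts (reverse_digraph T)"
    using s(1) by (simp add: reverse_digraph_def)
  ultimately show ?thesis
    using oriented_tree_reverse[OF tree] unfolding arborescence_def by blast
qed

lemma arborescence_dominator_chromatic_number_reverse:
  assumes "arborescence T"
  shows "dominator_chromatic_number T = dominator_chromatic_number (reverse_digraph T)"
proof -
  from assms obtain r parent where "rooted_digraph T r parent"
    by (rule arborescence_rooted)
  then interpret rooted_digraph T r parent .
  show ?thesis
    by (simp add: dominator_chromatic_number_away dominator_chromatic_number_towards)
qed

theorem corollary1:
  fixes T :: "'a pair_pre_digraph"
  assumes "arborescence T \<or> anti_arborescence T"
  shows "dominator_chromatic_number T = dominator_chromatic_number (reverse_digraph T)"
  using assms
proof
  assume "arborescence T"
  then show ?thesis by (rule arborescence_dominator_chromatic_number_reverse)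
next
  assume "anti_arborescence T"
  then have "arborescence (reverse_digraph T)" by (rule anti_arborescence_reverse)
  then show ?thesis using arborescence_dominator_chromatic_number_reverse by fastforce
qed

end
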